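(* Let $G$ be a group and let $R$ be a $G$-graded ring. a) Let $M$ be a cancellable monoid. Then $R$ is entire if and only if the $G\oplus\mathrm{Diff}(M)$-graded ring $R[M]$ is entire, and $R$ is reduced if and only if $R[M]$ is reduced. b) Let $M$ be a torsionfree, cancellable monoid, and let $d\colon M\to G$ be a morphism of monoids. Then the $G$-graded ring $R[M;d]$ is entire if and only if $R$ is entire, and $R[M;d]$ is reduced if and only if $R$ is reduced.
   Context: Groups and monoids are commutative and written additively; rings are commutative with $1$. A $G$-graded ring is a ring $R$ with a family $(R_g)_{g\in G}$ of additive subgroups whose direct sum is $R$ and with $R_gR_h\subseteq R_{g+h}$. A graded ring is entire if it is nonzero and every nonzero homogeneous element is a non-zerodivisor; it is reduced if no nonzero homogeneous element is nilpotent. For a monoid $M$, $\mathrm{Diff}(M)$ is its group of differences (Grothendieck group). $M$ is cancellable if and only if the canonical morphism $M\to\mathrm{Diff}(M)$ is injective. A cancellable monoid $M$ is torsionfree if and only if the group $\mathrm{Diff}(M)$ is torsionfree. For a cancellable monoid $M$, $R[M]$ (the finely graded algebra of $M$ over $R$) is the monoid algebra of $M$ over the ring underlying $R$, with canonical basis $(e_m)_{m\in M}$, furnished with the $G\oplus\mathrm{Diff}(M)$-graduation for which $re_m$ has degree $(g,m)$ for $r\in R_g$, $m\in M$. For a morphism of monoids $d\colon M\to G$, $R[M;d]$ (the $d$-graded algebra) is the same algebra with the $G$-graduation for which $re_m$ has degree $g+d(m)$ for $r\in R_g$, $m\in M$. *)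

theory Defs
  imports "HOL-Algebra.Algebra"
begin

text \<open>
  Groups and monoids are those of HOL-Algebra; the additive notation of the mathematics is
  rendered by the multiplicative record operations of \<open>G\<close> and \<open>M\<close>. Rings are \<^const>\<open>cring\<close>s,
  so the zero ring is allowed.
\<close>

text \<open>The direct sum condition is existence and uniqueness of finite decompositions.\<close>

locale graded_ring = grp: comm_group G + rng: cring R
  for G :: "('g, 'p) monoid_scheme" and R :: "('r, 'q) ring_scheme" +
  fixes A :: "'g \<Rightarrow> 'r set"
  assumes component_subgroup: "g \<in> carrier G \<Longrightarrow> additive_subgroup (A g) R"
    and direct_sum: "x \<in> carrier R \<Longrightarrow>
      \<exists>!f. f \<in> (\<Pi>\<^sub>E g\<in>carrier G. A g) \<and> finite {g \<in> carrier G. f g \<noteq> \<zero>\<^bsub>R\<^esub>} \<and>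
           x = (\<Oplus>\<^bsub>R\<^esub>g\<in>{g \<in> carrier G. f g \<noteq> \<zero>\<^bsub>R\<^esub>}. f g)"
    and mult_component: "\<lbrakk>g \<in> carrier G; h \<in> carrier G; x \<in> A g; y \<in> A h\<rbrakk> \<Longrightarrow>
      x \<otimes>\<^bsub>R\<^esub> y \<in> A (g \<otimes>\<^bsub>G\<^esub> h)"

definition homogeneous :: "('g, 'p) monoid_scheme \<Rightarrow> ('g \<Rightarrow> 'r set) \<Rightarrow> 'r set" where
  "homogeneous G A = (\<Union>g\<in>carrier G. A g)"

definition nonzerodivisor :: "('r, 'q) ring_scheme \<Rightarrow> 'r \<Rightarrow> bool" where
  "nonzerodivisor R x \<longleftrightarrow> x \<in> carrier R \<and> (\<forall>y\<in>carrier R. x \<otimes>\<^bsub>R\<^esub> y = \<zero>\<^bsub>R\<^esub> \<longrightarrow> y = \<zero>\<^bsub>R\<^esub>)"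

definition nilpotent :: "('r, 'q) ring_scheme \<Rightarrow> 'r \<Rightarrow> bool" where
  "nilpotent R x \<longleftrightarrow> x \<in> carrier R \<and> (\<exists>n::nat. x [^]\<^bsub>R\<^esub> n = \<zero>\<^bsub>R\<^esub>)"

definition graded_entire ::
  "('g, 'p) monoid_scheme \<Rightarrow> ('r, 'q) ring_scheme \<Rightarrow> ('g \<Rightarrow> 'r set) \<Rightarrow> bool" where
  "graded_entire G R A \<longleftrightarrow> carrier R \<noteq> {\<zero>\<^bsub>R\<^esub>} \<and>
     (\<forall>x\<in>homogeneous G A. x \<noteq> \<zero>\<^bsub>R\<^esub> \<longrightarrow> nonzerodivisor R x)"

definition graded_reduced ::
  "('g, 'p) monoid_scheme \<Rightarrow> ('r, 'q) ring_scheme \<Rightarrow> ('g \<Rightarrow> 'r set) \<Rightarrow> bool" where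
  "graded_reduced G R A \<longleftrightarrow>
     (\<forall>x\<in>homogeneous G A. x \<noteq> \<zero>\<^bsub>R\<^esub> \<longrightarrow> \<not> nilpotent R x)"

text \<open>
  The group of differences: the pair \<open>(a, b)\<close> stands for \<open>a - b\<close>. The extra summand \<open>k\<close> is
  needed for transitivity when \<open>M\<close> is not cancellable.
\<close>

definition diff_rel :: "('m, 's) monoid_scheme \<Rightarrow> (('m \<times> 'm) \<times> ('m \<times> 'm)) set" where
  "diff_rel M = {((a, b), (c, d)).
     a \<in> carrier M \<and> b \<in> carrier M \<and> c \<in> carrier M \<and> d \<in> carrier M \<and>
     (\<exists>k\<in>carrier M. a \<otimes>\<^bsub>M\<^esub> d \<otimes>\<^bsub>M\<^esub> k = c \<otimes>\<^bsub>M\<^esub> b \<otimes>\<^bsub>M\<^esub> k)}"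

definition Diff :: "('m, 's) monoid_scheme \<Rightarrow> ('m \<times> 'm) set monoid" where
  "Diff M = \<lparr>carrier = (carrier M \<times> carrier M) // diff_rel M,
     monoid.mult = (\<lambda>U V. diff_rel M ``
       {(a \<otimes>\<^bsub>M\<^esub> c, b \<otimes>\<^bsub>M\<^esub> d) | a b c d. (a, b) \<in> U \<and> (c, d) \<in> V}),
     one = diff_rel M `` {(\<one>\<^bsub>M\<^esub>, \<one>\<^bsub>M\<^esub>)}\<rparr>"

definition to_Diff :: "('m, 's) monoid_scheme \<Rightarrow> 'm \<Rightarrow> ('m \<times> 'm) set" where
  "to_Diff M m = diff_rel M `` {(m, \<one>\<^bsub>M\<^esub>)}"

definition cancellable :: "('m, 's) monoid_scheme \<Rightarrow> bool" where
  "cancellable M \<longleftrightarrow> (\<forall>a\<in>carrier M. \<forall>b\<in>carrier M. \<forall>c\<in>carrier M.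
     a \<otimes>\<^bsub>M\<^esub> c = b \<otimes>\<^bsub>M\<^esub> c \<longrightarrow> a = b)"

definition torsionfree_group :: "('g, 'p) monoid_scheme \<Rightarrow> bool" where
  "torsionfree_group G \<longleftrightarrow>
     (\<forall>x\<in>carrier G. \<forall>n::nat. 0 < n \<longrightarrow> x [^]\<^bsub>G\<^esub> n = \<one>\<^bsub>G\<^esub> \<longrightarrow> x = \<one>\<^bsub>G\<^esub>)"

text \<open>Only used for cancellable monoids.\<close>

definition torsionfree_monoid :: "('m, 's) monoid_scheme \<Rightarrow> bool" where
  "torsionfree_monoid M \<longleftrightarrow> torsionfree_group (Diff M)"

lemma equiv_diff_rel:
  assumes "comm_monoid M"
  shows "equiv (carrier M \<times> carrier M) (diff_rel M)"
proof (rule equivI)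
  interpret comm_monoid M by fact
  show "diff_rel M \<subseteq> (carrier M \<times> carrier M) \<times> (carrier M \<times> carrier M)"
    by (auto simp: diff_rel_def)
  show "refl_on (carrier M \<times> carrier M) (diff_rel M)"
    by (auto simp: refl_on_def diff_rel_def)
  show "sym (diff_rel M)"
    by (auto simp: sym_def diff_rel_def) metis
  show "trans (diff_rel M)"
  proof (rule transI)
    fix x y z assume "(x, y) \<in> diff_rel M" "(y, z) \<in> diff_rel M"
    then obtain a b c d e f k l where x: "x = (a, b)" "y = (c, d)" "z = (e, f)"
      and m: "a \<in> carrier M" "b \<in> carrier M" "c \<in> carrier M" "d \<in> carrier M"
        "e \<in> carrier M" "f \<in> carrier M" "k \<in> carrier M" "l \<in> carrier M"
      and eq: "a \<otimes>\<^bsub>M\<^esub> d \<otimes>\<^bsub>M\<^esub> k = c \<otimes>\<^bsub>M\<^esub> b \<otimes>\<^bsub>M\<^esub> k" "c \<otimes>\<^bsub>M\<^esub> f \<otimes>\<^bsub>M\<^esub> l = e \<otimes>\<^bsub>M\<^esub> d \<otimes>\<^bsub>M\<^esub> l"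
      by (auto simp: diff_rel_def)
    have "a \<otimes>\<^bsub>M\<^esub> f \<otimes>\<^bsub>M\<^esub> (d \<otimes>\<^bsub>M\<^esub> k \<otimes>\<^bsub>M\<^esub> l) = (a \<otimes>\<^bsub>M\<^esub> d \<otimes>\<^bsub>M\<^esub> k) \<otimes>\<^bsub>M\<^esub> (f \<otimes>\<^bsub>M\<^esub> l)"
      using m by (simp add: m_ac)
    also have "\<dots> = (c \<otimes>\<^bsub>M\<^esub> f \<otimes>\<^bsub>M\<^esub> l) \<otimes>\<^bsub>M\<^esub> (b \<otimes>\<^bsub>M\<^esub> k)"
      unfolding eq(1) using m by (simp add: m_ac)
    also have "\<dots> = e \<otimes>\<^bsub>M\<^esub> b \<otimes>\<^bsub>M\<^esub> (d \<otimes>\<^bsub>M\<^esub> k \<otimes>\<^bsub>M\<^esub> l)"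
      unfolding eq(2) using m by (simp add: m_ac)
    finally show "(x, z) \<in> diff_rel M"
      using m unfolding x diff_rel_def by auto
  qed
qed

lemma Diff_mult:
  assumes "comm_monoid M" and m: "a \<in> carrier M" "b \<in> carrier M" "c \<in> carrier M" "d \<in> carrier M"
  shows "diff_rel M `` {(a, b)} \<otimes>\<^bsub>Diff M\<^esub> diff_rel M `` {(c, d)} =
    diff_rel M `` {(a \<otimes>\<^bsub>M\<^esub> c, b \<otimes>\<^bsub>M\<^esub> d)}"
proof -
  interpret comm_monoid M by fact
  note eq = equiv_diff_rel[OF assms(1)]
  have cong: "((a \<otimes>\<^bsub>M\<^esub> c, b \<otimes>\<^bsub>M\<^esub> d), (a' \<otimes>\<^bsub>M\<^esub> c', b' \<otimes>\<^bsub>M\<^esub> d')) \<in> diff_rel M"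
    if "((a, b), (a', b')) \<in> diff_rel M" "((c, d), (c', d')) \<in> diff_rel M" for a' b' c' d'
  proof -
    from that obtain k l where m': "a' \<in> carrier M" "b' \<in> carrier M" "c' \<in> carrier M"
        "d' \<in> carrier M" "k \<in> carrier M" "l \<in> carrier M"
      and e: "a \<otimes>\<^bsub>M\<^esub> b' \<otimes>\<^bsub>M\<^esub> k = a' \<otimes>\<^bsub>M\<^esub> b \<otimes>\<^bsub>M\<^esub> k" "c \<otimes>\<^bsub>M\<^esub> d' \<otimes>\<^bsub>M\<^esub> l = c' \<otimes>\<^bsub>M\<^esub> d \<otimes>\<^bsub>M\<^esub> l"
      by (auto simp: diff_rel_def)
    have "a \<otimes>\<^bsub>M\<^esub> c \<otimes>\<^bsub>M\<^esub> (b' \<otimes>\<^bsub>M\<^esub> d') \<otimes>\<^bsub>M\<^esub> (k \<otimes>\<^bsub>M\<^esub> l) =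
        (a \<otimes>\<^bsub>M\<^esub> b' \<otimes>\<^bsub>M\<^esub> k) \<otimes>\<^bsub>M\<^esub> (c \<otimes>\<^bsub>M\<^esub> d' \<otimes>\<^bsub>M\<^esub> l)"
      using m m' by (simp add: m_ac)
    also have "\<dots> = a' \<otimes>\<^bsub>M\<^esub> c' \<otimes>\<^bsub>M\<^esub> (b \<otimes>\<^bsub>M\<^esub> d) \<otimes>\<^bsub>M\<^esub> (k \<otimes>\<^bsub>M\<^esub> l)"
      unfolding e using m m' by (simp add: m_ac)
    finally show ?thesis
      using m m' by (auto simp: diff_rel_def)
  qed
  have self: "((a, b), (a, b)) \<in> diff_rel M" "((c, d), (c, d)) \<in> diff_rel M"
    using m by (auto simp: diff_rel_def)
  show ?thesis
  proof (intro equalityI subsetI)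
    fix z assume "z \<in> diff_rel M `` {(a, b)} \<otimes>\<^bsub>Diff M\<^esub> diff_rel M `` {(c, d)}"
    then obtain a' b' c' d' where "((a, b), (a', b')) \<in> diff_rel M" "((c, d), (c', d')) \<in> diff_rel M"
      "((a' \<otimes>\<^bsub>M\<^esub> c', b' \<otimes>\<^bsub>M\<^esub> d'), z) \<in> diff_rel M"
      by (auto simp: Diff_def)
    with cong equivE[OF eq] show "z \<in> diff_rel M `` {(a \<otimes>\<^bsub>M\<^esub> c, b \<otimes>\<^bsub>M\<^esub> d)}"
      by (metis Image_singleton_iff transD)
  next
    fix z assume "z \<in> diff_rel M `` {(a \<otimes>\<^bsub>M\<^esub> c, b \<otimes>\<^bsub>M\<^esub> d)}"
    with self show "z \<in> diff_rel M `` {(a, b)} \<otimes>\<^bsub>Diff M\<^esub> diff_rel M `` {(c, d)}"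
      by (simp add: Diff_def) (rule ImageI, assumption, blast)
  qed
qed

lemma comm_group_Diff:
  assumes "comm_monoid M"
  shows "comm_group (Diff M)"
proof -
  interpret comm_monoid M by fact
  have cE: "\<exists>a\<in>carrier M. \<exists>b\<in>carrier M. x = diff_rel M `` {(a, b)}" if "x \<in> carrier (Diff M)" for x
    using that by (auto simp: Diff_def quotient_def)
  have cI: "diff_rel M `` {(a, b)} \<in> carrier (Diff M)" if "a \<in> carrier M" "b \<in> carrier M" for a b
    using that by (auto simp: Diff_def quotient_def)
  have one: "\<one>\<^bsub>Diff M\<^esub> = diff_rel M `` {(\<one>\<^bsub>M\<^esub>, \<one>\<^bsub>M\<^esub>)}"
    by (simp add: Diff_def)
  note mult = Diff_mult[OF assms]
  show ?thesis
  proof (rule comm_groupI)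
    fix x y assume "x \<in> carrier (Diff M)" "y \<in> carrier (Diff M)"
    then obtain a b c d where m: "a \<in> carrier M" "b \<in> carrier M" "c \<in> carrier M" "d \<in> carrier M"
      and xy: "x = diff_rel M `` {(a, b)}" "y = diff_rel M `` {(c, d)}"
      using cE by meson
    show "x \<otimes>\<^bsub>Diff M\<^esub> y \<in> carrier (Diff M)" "x \<otimes>\<^bsub>Diff M\<^esub> y = y \<otimes>\<^bsub>Diff M\<^esub> x"
      using m by (simp_all add: xy mult cI m_comm)
  next
    show "\<one>\<^bsub>Diff M\<^esub> \<in> carrier (Diff M)"
      by (simp add: one cI)
  next
    fix x y z assume "x \<in> carrier (Diff M)" "y \<in> carrier (Diff M)" "z \<in> carrier (Diff M)"
    then obtain a b c d e f where m: "a \<in> carrier M" "b \<in> carrier M" "c \<in> carrier M"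
        "d \<in> carrier M" "e \<in> carrier M" "f \<in> carrier M"
      and xyz: "x = diff_rel M `` {(a, b)}" "y = diff_rel M `` {(c, d)}" "z = diff_rel M `` {(e, f)}"
      using cE by meson
    show "x \<otimes>\<^bsub>Diff M\<^esub> y \<otimes>\<^bsub>Diff M\<^esub> z = x \<otimes>\<^bsub>Diff M\<^esub> (y \<otimes>\<^bsub>Diff M\<^esub> z)"
      using m by (simp add: xyz mult m_assoc)
  next
    fix x assume "x \<in> carrier (Diff M)"
    then obtain a b where m: "a \<in> carrier M" "b \<in> carrier M" and x: "x = diff_rel M `` {(a, b)}"
      using cE by meson
    show "\<one>\<^bsub>Diff M\<^esub> \<otimes>\<^bsub>Diff M\<^esub> x = x"
      using m by (simp add: one x mult)
    have "((b \<otimes>\<^bsub>M\<^esub> a, a \<otimes>\<^bsub>M\<^esub> b), (\<one>\<^bsub>M\<^esub>, \<one>\<^bsub>M\<^esub>)) \<in> diff_rel M"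
      using m by (auto simp: diff_rel_def m_comm)
    then have "diff_rel M `` {(b, a)} \<otimes>\<^bsub>Diff M\<^esub> x = \<one>\<^bsub>Diff M\<^esub>"
      using m equiv_class_eq[OF equiv_diff_rel[OF assms]] by (simp add: one x mult)
    then show "\<exists>y\<in>carrier (Diff M). y \<otimes>\<^bsub>Diff M\<^esub> x = \<one>\<^bsub>Diff M\<^esub>"
      using m cI by blast
  qed
qed

lemma cancellable_iff_inj_to_Diff:
  assumes "comm_monoid M"
  shows "cancellable M \<longleftrightarrow> inj_on (to_Diff M) (carrier M)"
proof -
  interpret comm_monoid M by fact
  have "to_Diff M a = to_Diff M b \<longleftrightarrow> (\<exists>k\<in>carrier M. a \<otimes>\<^bsub>M\<^esub> k = b \<otimes>\<^bsub>M\<^esub> k)"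
    if "a \<in> carrier M" "b \<in> carrier M" for a b
    using that eq_equiv_class_iff[OF equiv_diff_rel[OF assms], of "(a, \<one>\<^bsub>M\<^esub>)" "(b, \<one>\<^bsub>M\<^esub>)"]
    by (simp add: to_Diff_def diff_rel_def)
  then show ?thesis
    unfolding cancellable_def inj_on_def by blast
qed

lemma torsionfree_monoid_iff:
  assumes "comm_monoid M" and canc: "cancellable M"
  shows "torsionfree_monoid M \<longleftrightarrow> (\<forall>a\<in>carrier M. \<forall>b\<in>carrier M. \<forall>n::nat. 0 < n \<longrightarrow>
    a [^]\<^bsub>M\<^esub> n = b [^]\<^bsub>M\<^esub> n \<longrightarrow> a = b)"
proof -
  interpret comm_monoid M by fact
  interpret D: comm_group "Diff M" by (rule comm_group_Diff) fact
  have pow: "(diff_rel M `` {(a, b)}) [^]\<^bsub>Diff M\<^esub> n = diff_rel M `` {(a [^]\<^bsub>M\<^esub> n, b [^]\<^bsub>M\<^esub> n)}"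
    if "a \<in> carrier M" "b \<in> carrier M" for a b and n :: nat
  proof (induction n)
    case 0
    have "\<one>\<^bsub>Diff M\<^esub> = diff_rel M `` {(\<one>\<^bsub>M\<^esub>, \<one>\<^bsub>M\<^esub>)}"
      by (simp add: Diff_def)
    then show ?case by simp
  next
    case (Suc n)
    then show ?case
      using that Diff_mult[OF assms(1), of "a [^]\<^bsub>M\<^esub> n" "b [^]\<^bsub>M\<^esub> n" a b]
      by simp
  qed
  have one: "diff_rel M `` {(a, b)} = \<one>\<^bsub>Diff M\<^esub> \<longleftrightarrow> a = b"
    if ab: "a \<in> carrier M" "b \<in> carrier M" for a b
  proof -
    have "\<one>\<^bsub>Diff M\<^esub> = diff_rel M `` {(\<one>\<^bsub>M\<^esub>, \<one>\<^bsub>M\<^esub>)}"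
      by (simp add: Diff_def)
    then have "diff_rel M `` {(a, b)} = \<one>\<^bsub>Diff M\<^esub> \<longleftrightarrow> ((a, b), (\<one>\<^bsub>M\<^esub>, \<one>\<^bsub>M\<^esub>)) \<in> diff_rel M"
      using eq_equiv_class_iff[OF equiv_diff_rel[OF assms(1)], of "(a, b)" "(\<one>\<^bsub>M\<^esub>, \<one>\<^bsub>M\<^esub>)"] ab by simp
    also have "\<dots> \<longleftrightarrow> (\<exists>k\<in>carrier M. a \<otimes>\<^bsub>M\<^esub> k = b \<otimes>\<^bsub>M\<^esub> k)"
      using ab by (simp add: diff_rel_def)
    also have "\<dots> \<longleftrightarrow> a = b"
      using ab canc one_closed unfolding cancellable_def by blast
    finally show ?thesis .
  qed
  have carrier: "carrier (Diff M) = (\<lambda>(a, b). diff_rel M `` {(a, b)}) ` (carrier M \<times> carrier M)"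
    by (auto simp: Diff_def quotient_def)
  have "torsionfree_monoid M \<longleftrightarrow> (\<forall>a\<in>carrier M. \<forall>b\<in>carrier M. \<forall>n::nat. 0 < n \<longrightarrow>
      (diff_rel M `` {(a, b)}) [^]\<^bsub>Diff M\<^esub> n = \<one>\<^bsub>Diff M\<^esub> \<longrightarrow> diff_rel M `` {(a, b)} = \<one>\<^bsub>Diff M\<^esub>)"
    unfolding torsionfree_monoid_def torsionfree_group_def carrier by simp
  also have "\<dots> \<longleftrightarrow> (\<forall>a\<in>carrier M. \<forall>b\<in>carrier M. \<forall>n::nat. 0 < n \<longrightarrow>
      a [^]\<^bsub>M\<^esub> n = b [^]\<^bsub>M\<^esub> n \<longrightarrow> a = b)"
    by (intro ball_cong refl all_cong1) (simp only: pow one nat_pow_closed)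
  finally show ?thesis .
qed

text \<open>Membership in \<^const>\<open>hom\<close> suffices for a morphism of monoids into a group.\<close>

lemma hom_monoid_group_one:
  assumes "comm_monoid M" and "comm_group G" and "d \<in> hom M G"
  shows "d \<one>\<^bsub>M\<^esub> = \<one>\<^bsub>G\<^esub>"
proof -
  interpret M: comm_monoid M by fact
  interpret G: comm_group G by fact
  have "d \<one>\<^bsub>M\<^esub> \<in> carrier G" "d \<one>\<^bsub>M\<^esub> \<otimes>\<^bsub>G\<^esub> d \<one>\<^bsub>M\<^esub> = d \<one>\<^bsub>M\<^esub>"
    using assms(3) hom_mult[OF assms(3) M.one_closed M.one_closed] by (auto simp: hom_def)
  then show ?thesis
    using G.l_cancel_one by blast
qed

text \<open>
  The monoid algebra: finitely supported functions with convolution, extended by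
  \<^const>\<open>undefined\<close> outside \<^term>\<open>carrier M\<close>.
\<close>

definition supp :: "('r, 'q) ring_scheme \<Rightarrow> ('m, 's) monoid_scheme \<Rightarrow> ('m \<Rightarrow> 'r) \<Rightarrow> 'm set" where
  "supp R M u = {m \<in> carrier M. u m \<noteq> \<zero>\<^bsub>R\<^esub>}"

definition monoid_algebra ::
  "('r, 'q) ring_scheme \<Rightarrow> ('m, 's) monoid_scheme \<Rightarrow> ('m \<Rightarrow> 'r) ring" where
  "monoid_algebra R M = \<lparr>
     carrier = {u \<in> carrier M \<rightarrow>\<^sub>E carrier R. finite (supp R M u)},
     monoid.mult = (\<lambda>u v. \<lambda>m\<in>carrier M.
       \<Oplus>\<^bsub>R\<^esub>p\<in>{p \<in> supp R M u \<times> supp R M v. fst p \<otimes>\<^bsub>M\<^esub> snd p = m}. u (fst p) \<otimes>\<^bsub>R\<^esub> v (snd p)),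
     one = (\<lambda>m\<in>carrier M. if m = \<one>\<^bsub>M\<^esub> then \<one>\<^bsub>R\<^esub> else \<zero>\<^bsub>R\<^esub>),
     ring.zero = (\<lambda>m\<in>carrier M. \<zero>\<^bsub>R\<^esub>),
     ring.add = (\<lambda>u v. \<lambda>m\<in>carrier M. u m \<oplus>\<^bsub>R\<^esub> v m)\<rparr>"

text \<open>The element \<open>r e\<^sub>m\<close>.\<close>

definition mterm ::
  "('r, 'q) ring_scheme \<Rightarrow> ('m, 's) monoid_scheme \<Rightarrow> 'r \<Rightarrow> 'm \<Rightarrow> ('m \<Rightarrow> 'r)" where
  "mterm R M r m = (\<lambda>n\<in>carrier M. if n = m then r else \<zero>\<^bsub>R\<^esub>)"

text \<open>
  The graduation of the monoid algebra for which \<open>r e\<^sub>m\<close> has degree \<open>\<delta> g m\<close> for \<open>r \<in> A g\<close>: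
  its component of degree \<open>h\<close> is the additive subgroup generated by these \<open>r e\<^sub>m\<close>
  with \<open>\<delta> g m = h\<close>.
\<close>

definition algebra_grading ::
  "('g, 'p) monoid_scheme \<Rightarrow> ('r, 'q) ring_scheme \<Rightarrow> ('g \<Rightarrow> 'r set) \<Rightarrow>
   ('m, 's) monoid_scheme \<Rightarrow> ('g \<Rightarrow> 'm \<Rightarrow> 'h) \<Rightarrow> 'h \<Rightarrow> ('m \<Rightarrow> 'r) set" where
  "algebra_grading G R A M \<delta> h = generate (add_monoid (monoid_algebra R M))
     {mterm R M r m | g r m. g \<in> carrier G \<and> r \<in> A g \<and> m \<in> carrier M \<and> \<delta> g m = h}"

definition fine_grading ::
  "('g, 'p) monoid_scheme \<Rightarrow> ('r, 'q) ring_scheme \<Rightarrow> ('g \<Rightarrow> 'r set) \<Rightarrow>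
   ('m, 's) monoid_scheme \<Rightarrow> 'g \<times> ('m \<times> 'm) set \<Rightarrow> ('m \<Rightarrow> 'r) set" where
  "fine_grading G R A M = algebra_grading G R A M (\<lambda>g m. (g, to_Diff M m))"

definition coarse_grading ::
  "('g, 'p) monoid_scheme \<Rightarrow> ('r, 'q) ring_scheme \<Rightarrow> ('g \<Rightarrow> 'r set) \<Rightarrow>
   ('m, 's) monoid_scheme \<Rightarrow> ('m \<Rightarrow> 'g) \<Rightarrow> 'g \<Rightarrow> ('m \<Rightarrow> 'r) set" where
  "coarse_grading G R A M d = algebra_grading G R A M (\<lambda>g m. g \<otimes>\<^bsub>G\<^esub> d m)"

end

theory Submission
  imports Defs
begin

text \<open>
  All four equivalences are instances of one leading term argument. A homogeneous element of a
  monoid algebra, for either graduation, has homogeneous coefficients. Suppose that \<open>M\<close> carries a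
  partial order invariant under translations and that the support of \<open>u\<close> has a greatest element
  \<open>m\<close>. For every nonzero \<open>v\<close>, choose a maximal element \<open>n\<close> of the support of \<open>v\<close>; then \<open>(m, n)\<close>
  is the only pair in the product of the supports whose product is \<open>m \<otimes> n\<close>, so the coefficient
  of \<open>u \<otimes> v\<close> there is \<open>u m \<otimes> v n\<close>. It follows that \<open>u\<close> is a nonzerodivisor if \<open>u m\<close> is one
  (\<open>nonzerodivisor_leading\<close>). In the same way the coefficient of \<open>u [^] k\<close> at \<open>m [^] k\<close> is
  \<open>u m [^] k\<close>, so \<open>u m\<close> is nilpotent if \<open>u\<close> is (\<open>nilpotent_leading\<close>). Conversely, \<open>R\<close> sits in
  the monoid algebra in the degrees belonging to the neutral element of \<open>M\<close>, so both properties
  descend to \<open>R\<close>. This is put together in \<open>algebra_grading_transfer\<close>.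

  For the fine graduation of a cancellable monoid, homogeneous elements have at most one term, and
  equality serves as the order. For the coarse graduation a total order is needed. If \<open>M\<close> is
  torsionfree and cancellable, it embeds into the torsionfree group \<open>Diff M\<close>, and by Zorn's lemma
  this group has a maximal cone, which defines a total order (\<open>torsionfree_total_cone\<close>).
\<close>

section \<open>Total orders on torsionfree abelian groups\<close>

definition cone :: "('g, 'p) monoid_scheme \<Rightarrow> 'g set \<Rightarrow> bool" where
  "cone G P \<longleftrightarrow> P \<subseteq> carrier G \<and> \<one>\<^bsub>G\<^esub> \<in> P \<and> (\<forall>x\<in>P. \<forall>y\<in>P. x \<otimes>\<^bsub>G\<^esub> y \<in> P) \<and>
     (\<forall>x\<in>P. inv\<^bsub>G\<^esub> x \<in> P \<longrightarrow> x = \<one>\<^bsub>G\<^esub>)"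

lemma cone_pow:
  assumes "cone G P" "x \<in> P"
  shows "x [^]\<^bsub>G\<^esub> (n::nat) \<in> P"
  using assms by (induction n) (auto simp: cone_def)

text \<open>
  The set \<open>P + \<nat>x\<close> is closed under addition. By maximality it either equals \<open>P\<close> or fails to be
  pointed, and in the latter case a negative multiple of \<open>x\<close> lies in \<open>P\<close>.
\<close>

lemma (in comm_group) maximal_cone_power:
  assumes P: "cone G P" and max: "\<And>Q. cone G Q \<Longrightarrow> P \<subseteq> Q \<Longrightarrow> Q = P"
    and x: "x \<in> carrier G" "x \<notin> P"
  obtains n :: nat where "0 < n" "inv (x [^] n) \<in> P"
proof -
  define Q where "Q = {p \<otimes> x [^] k | p k. p \<in> P \<and> (k::nat) \<in> UNIV}"
  have PG: "p \<in> carrier G" if "p \<in> P" for p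
    using P that by (auto simp: cone_def)
  have one: "\<one> \<in> P" and mult: "\<And>p q. p \<in> P \<Longrightarrow> q \<in> P \<Longrightarrow> p \<otimes> q \<in> P"
    and pointed: "\<And>p. p \<in> P \<Longrightarrow> inv p \<in> P \<Longrightarrow> p = \<one>"
    using P by (auto simp: cone_def)
  have QI: "p \<otimes> x [^] k \<in> Q" if "p \<in> P" for p and k :: nat
    using that by (auto simp: Q_def)
  have prod: "p \<otimes> x [^] k \<otimes> (q \<otimes> x [^] l) = p \<otimes> q \<otimes> x [^] (k + l)"
    if "p \<in> P" "q \<in> P" for p q and k l :: nat
    using that PG x by (simp add: nat_pow_mult[symmetric] m_ac del: nat_pow_mult)
  have "x \<in> Q"
    using QI[OF one, of 1] x by simp
  have "P \<subseteq> Q"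
    using QI[of _ 0] PG by auto
  have "\<not> cone G Q"
    using max[OF _ \<open>P \<subseteq> Q\<close>] \<open>x \<in> Q\<close> x by blast
  moreover have "Q \<subseteq> carrier G"
    using PG x by (auto simp: Q_def)
  moreover have "\<one> \<in> Q"
    using \<open>P \<subseteq> Q\<close> one by blast
  moreover have "\<forall>y\<in>Q. \<forall>z\<in>Q. y \<otimes> z \<in> Q"
  proof (intro ballI)
    fix y z assume "y \<in> Q" "z \<in> Q"
    then obtain p q and k l :: nat where "p \<in> P" "q \<in> P" "y = p \<otimes> x [^] k" "z = q \<otimes> x [^] l"
      by (auto simp: Q_def)
    then show "y \<otimes> z \<in> Q"
      by (simp only: prod QI mult)
  qed
  ultimately obtain z where z: "z \<in> Q" "inv z \<in> Q" "z \<noteq> \<one>"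
    by (auto simp: cone_def)
  from z obtain p k q l where pq: "p \<in> P" "q \<in> P"
    and zp: "z = p \<otimes> x [^] (k::nat)" and zq: "inv z = q \<otimes> x [^] (l::nat)"
    by (auto simp: Q_def)
  have "z \<in> carrier G"
    using pq PG x zp by simp
  then have eq: "p \<otimes> q \<otimes> x [^] (k + l) = \<one>"
    using prod[OF pq, of k l] zp zq r_inv by metis
  have inv: "inv (x [^] (k + l)) = p \<otimes> q"
    using eq pq PG x by (metis inv_equality m_closed nat_pow_closed)
  have "k + l \<noteq> 0"
  proof
    assume kl: "k + l = 0"
    then have "p \<otimes> q = \<one>" "z = p"
      using eq pq PG zp by auto
    then have "inv p = q"
      using pq PG by (metis inv_equality m_comm)
    then show False
      using pointed[of p] pq z \<open>z = p\<close> by simp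
  qed
  then show thesis
    using that[of "k + l"] inv mult pq by simp
qed

text \<open>Every torsionfree abelian group can be totally ordered (Levi).\<close>

lemma (in comm_group) torsionfree_total_cone:
  assumes "torsionfree_group G"
  obtains P where "cone G P" "\<And>x. x \<in> carrier G \<Longrightarrow> x \<in> P \<or> inv x \<in> P"
proof -
  have "cone G {\<one>}"
    by (auto simp: cone_def)
  moreover have "\<Union>C \<in> Collect (cone G)" if C: "C \<noteq> {}" "subset.chain (Collect (cone G)) C" for C
  proof -
    have *: "\<exists>P\<in>C. x \<in> P \<and> y \<in> P" if xy: "x \<in> \<Union>C" "y \<in> \<Union>C" for x y
    proof -
      from xy obtain S T where "S \<in> C" "T \<in> C" "x \<in> S" "y \<in> T"
        by blast
      moreover have "S \<subseteq> T \<or> T \<subseteq> S"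
        using C(2) calculation(1,2) by (simp add: subset_chain_def)
      ultimately show ?thesis
        by blast
    qed
    have con: "cone G P" if "P \<in> C" for P
      using C that by (auto simp: subset_chain_def)
    have "\<Union>C \<subseteq> carrier G"
      using con by (intro Union_least) (simp add: cone_def)
    moreover have "\<one> \<in> \<Union>C"
      using con C(1) by (fastforce simp: cone_def)
    moreover have "x \<otimes> y \<in> \<Union>C" if xy: "x \<in> \<Union>C" "y \<in> \<Union>C" for x y
    proof -
      obtain P where "P \<in> C" "x \<in> P" "y \<in> P"
        using *[OF xy] by blast
      then show ?thesis
        using con[of P] by (auto simp: cone_def)
    qed
    moreover have "x = \<one>" if x: "x \<in> \<Union>C" "inv x \<in> \<Union>C" for x
    proof -
      obtain P where "P \<in> C" "x \<in> P" "inv x \<in> P"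
        using *[OF x] by blast
      then show ?thesis
        using con[of P] by (auto simp: cone_def)
    qed
    ultimately show ?thesis
      unfolding cone_def mem_Collect_eq by (intro conjI ballI impI) assumption+
  qed
  ultimately obtain P where P: "cone G P" and max: "\<And>Q. cone G Q \<Longrightarrow> P \<subseteq> Q \<Longrightarrow> Q = P"
    using subset_Zorn_nonempty[of "Collect (cone G)"] by (metis (full_types) empty_iff mem_Collect_eq)
  have "x \<in> P \<or> inv x \<in> P" if x: "x \<in> carrier G" for x
  proof (rule ccontr)
    assume "\<not> ?thesis"
    then have nx: "x \<notin> P" "inv x \<notin> P"
      by auto
    obtain n :: nat where n: "0 < n" "inv (x [^] n) \<in> P"
      using maximal_cone_power[OF P max x nx(1)] by blast
    obtain k :: nat where k: "0 < k" "inv (inv x [^] k) \<in> P"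
      using maximal_cone_power[OF P max _ nx(2)] x by blast
    have "inv (inv x [^] k) = x [^] k"
      using x by (simp add: nat_pow_inv)
    then have "(x [^] k) [^] n \<in> P" "(inv (x [^] n)) [^] k \<in> P"
      using n k cone_pow[OF P] by auto
    moreover have "(x [^] k) [^] n = x [^] (n * k)"
      using x by (simp add: nat_pow_pow mult.commute)
    moreover have "(inv (x [^] n)) [^] k = inv (x [^] (n * k))"
      using x by (simp only: nat_pow_inv nat_pow_closed nat_pow_pow)
    ultimately have "x [^] (n * k) \<in> P" "inv (x [^] (n * k)) \<in> P"
      by simp_all
    then have "x [^] (n * k) = \<one>"
      using P by (simp add: cone_def)
    then have "x = \<one>"
      using assms x n(1) k(1) unfolding torsionfree_group_def by (metis nat_0_less_mult_iff)
    then show False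
      using nx P by (auto simp: cone_def)
  qed
  with P show thesis
    by (rule that)
qed

section \<open>Translation invariant orders on monoids\<close>

locale translation_order = comm_monoid M for M (structure) +
  fixes le :: "'a \<Rightarrow> 'a \<Rightarrow> bool" (infix "\<preceq>" 50)
  assumes le_refl: "a \<in> carrier M \<Longrightarrow> a \<preceq> a"
    and le_antisym: "\<lbrakk>a \<in> carrier M; b \<in> carrier M; a \<preceq> b; b \<preceq> a\<rbrakk> \<Longrightarrow> a = b"
    and le_trans: "\<lbrakk>a \<in> carrier M; b \<in> carrier M; c \<in> carrier M; a \<preceq> b; b \<preceq> c\<rbrakk> \<Longrightarrow> a \<preceq> c"
    and le_translate: "\<lbrakk>a \<in> carrier M; b \<in> carrier M; c \<in> carrier M\<rbrakk> \<Longrightarrow>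
      a \<otimes> c \<preceq> b \<otimes> c \<longleftrightarrow> a \<preceq> b"
begin

lemma mult_mono:
  assumes "a \<in> carrier M" "b \<in> carrier M" "c \<in> carrier M" "e \<in> carrier M" "a \<preceq> b" "c \<preceq> e"
  shows "a \<otimes> c \<preceq> b \<otimes> e"
proof (rule le_trans)
  show "a \<otimes> c \<preceq> b \<otimes> c"
    using assms by (simp add: le_translate)
  show "b \<otimes> c \<preceq> b \<otimes> e"
    using assms le_translate[of c e b] by (simp add: m_comm)
qed (use assms in auto)

text \<open>
  Bounding only one of the two factors from above suffices, if the other one is compared with an
  element that it cannot exceed. This asymmetry makes the argument work for orders that are not
  total.
\<close>

lemma unique_product:
  assumes M: "a \<in> carrier M" "b \<in> carrier M" "m \<in> carrier M" "n \<in> carrier M"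
    and eq: "a \<otimes> b = m \<otimes> n" and "a \<preceq> m" and max: "n \<preceq> b \<Longrightarrow> b = n"
  shows "a = m \<and> b = n"
proof -
  have "n \<otimes> m \<preceq> b \<otimes> m"
    using le_translate[of a m b] assms by (simp add: m_comm)
  then have "b = n"
    using max M by (simp add: le_translate)
  moreover have "m \<otimes> n \<preceq> a \<otimes> n"
    using eq \<open>b = n\<close> M by (simp add: le_refl)
  ultimately show ?thesis
    using M \<open>a \<preceq> m\<close> by (auto simp: le_translate intro: le_antisym)
qed

lemma finite_maximal:
  assumes "finite S" "S \<noteq> {}" "S \<subseteq> carrier M"
  obtains n where "n \<in> S" "\<And>b. b \<in> S \<Longrightarrow> n \<preceq> b \<Longrightarrow> b = n"
proof -
  have "asymp_on S (\<lambda>a b. a \<preceq> b \<and> a \<noteq> b)"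
    using assms(3) by (auto intro!: asymp_onI dest: le_antisym)
  moreover have "transp_on S (\<lambda>a b. a \<preceq> b \<and> a \<noteq> b)"
  proof (rule transp_onI, elim conjE, intro conjI)
    fix a b c assume "a \<in> S" "b \<in> S" "c \<in> S" and le: "a \<preceq> b" "a \<noteq> b" "b \<preceq> c"
    then have M: "a \<in> carrier M" "b \<in> carrier M" "c \<in> carrier M"
      using assms(3) by auto
    show "a \<preceq> c"
      by (rule le_trans[of a b c]) fact+
    show "a \<noteq> c"
      using le_antisym[OF M(1,2)] le by blast
  qed
  ultimately obtain n where n: "n \<in> S" "\<forall>b\<in>S. b \<noteq> n \<longrightarrow> \<not> (n \<preceq> b \<and> n \<noteq> b)"
    using Finite_Set.bex_max_element[OF assms(1) _ _ assms(2)] by blast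
  show thesis
    by (rule that[OF n(1)]) (use n(2) in blast)
qed

end

lemma cancellable_translation_order:
  assumes "comm_monoid M" "cancellable M"
  shows "translation_order M (=)"
proof -
  interpret comm_monoid M by fact
  show ?thesis
  proof unfold_locales
    fix a b c assume "a \<in> carrier M" "b \<in> carrier M" "c \<in> carrier M"
    then show "a \<otimes>\<^bsub>M\<^esub> c = b \<otimes>\<^bsub>M\<^esub> c \<longleftrightarrow> a = b"
      using assms(2) unfolding cancellable_def by metis
  qed (assumption | rule refl | erule (1) trans)+
qed

lemma to_Diff_hom:
  assumes "comm_monoid M"
  shows "to_Diff M \<in> hom M (Diff M)"
proof -
  interpret comm_monoid M by fact
  show ?thesis
  proof (rule homI)
    fix a assume "a \<in> carrier M"
    then show "to_Diff M a \<in> carrier (Diff M)"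
      unfolding to_Diff_def Diff_def by (simp add: quotientI)
  next
    fix a b assume "a \<in> carrier M" "b \<in> carrier M"
    then show "to_Diff M (a \<otimes>\<^bsub>M\<^esub> b) = to_Diff M a \<otimes>\<^bsub>Diff M\<^esub> to_Diff M b"
      unfolding to_Diff_def using Diff_mult[OF assms, of a "\<one>\<^bsub>M\<^esub>" b "\<one>\<^bsub>M\<^esub>"] by simp
  qed
qed

text \<open>
  The order is pulled back along \<open>M \<rightarrow> Diff M\<close>: \<open>a\<close> is below \<open>b\<close> if their difference \<open>b - a\<close>
  lies in a total cone. Cancellability makes the map injective and hence the order antisymmetric.
\<close>

lemma torsionfree_translation_order:
  assumes M: "comm_monoid M" "cancellable M" "torsionfree_monoid M"
  obtains le where "translation_order M le"
    "\<And>a b. a \<in> carrier M \<Longrightarrow> b \<in> carrier M \<Longrightarrow> le a b \<or> le b a"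
proof -
  interpret M: comm_monoid M by fact
  interpret D: comm_group "Diff M" by (rule comm_group_Diff) fact
  obtain P where P: "cone (Diff M) P"
    and total: "\<And>x. x \<in> carrier (Diff M) \<Longrightarrow> x \<in> P \<or> inv\<^bsub>Diff M\<^esub> x \<in> P"
    using D.torsionfree_total_cone M(3) unfolding torsionfree_monoid_def by blast
  let ?q = "to_Diff M"
  have q: "?q a \<in> carrier (Diff M)" if "a \<in> carrier M" for a
    using to_Diff_hom[OF M(1)] that by (auto simp: hom_def)
  have q_mult: "?q (a \<otimes>\<^bsub>M\<^esub> b) = ?q a \<otimes>\<^bsub>Diff M\<^esub> ?q b" if "a \<in> carrier M" "b \<in> carrier M" for a b
    using to_Diff_hom[OF M(1)] that by (auto simp: hom_def)
  have q_inj: "a = b" if "a \<in> carrier M" "b \<in> carrier M" "?q a = ?q b" for a b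
    using cancellable_iff_inj_to_Diff[OF M(1)] M(2) that by (auto simp: inj_on_def)
  define le where "le a b \<longleftrightarrow> ?q b \<otimes>\<^bsub>Diff M\<^esub> inv\<^bsub>Diff M\<^esub> ?q a \<in> P" for a b
  have inv: "inv\<^bsub>Diff M\<^esub> (?q b \<otimes>\<^bsub>Diff M\<^esub> inv\<^bsub>Diff M\<^esub> ?q a) = ?q a \<otimes>\<^bsub>Diff M\<^esub> inv\<^bsub>Diff M\<^esub> ?q b"
    if "a \<in> carrier M" "b \<in> carrier M" for a b
    using q that by (simp add: D.inv_mult_group)
  have cancel: "x \<otimes>\<^bsub>Diff M\<^esub> (inv\<^bsub>Diff M\<^esub> x \<otimes>\<^bsub>Diff M\<^esub> y) = y"
    if "x \<in> carrier (Diff M)" "y \<in> carrier (Diff M)" for x y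
    using that by (simp flip: D.m_assoc)
  have "translation_order M le"
  proof unfold_locales
    fix a assume "a \<in> carrier M"
    then show "le a a"
      using P q by (simp add: le_def cone_def)
  next
    fix a b assume ab: "a \<in> carrier M" "b \<in> carrier M" "le a b" "le b a"
    then have "?q b \<otimes>\<^bsub>Diff M\<^esub> inv\<^bsub>Diff M\<^esub> ?q a = \<one>\<^bsub>Diff M\<^esub>"
      using P inv by (auto simp: le_def cone_def)
    then have "?q b = ?q a"
      using ab q D.inv_solve_right[of "\<one>\<^bsub>Diff M\<^esub>" "?q b" "?q a"] by simp
    then show "a = b"
      using ab q_inj by metis
  next
    fix a b c assume abc: "a \<in> carrier M" "b \<in> carrier M" "c \<in> carrier M" and le: "le a b" "le b c"
    have "(?q c \<otimes>\<^bsub>Diff M\<^esub> inv\<^bsub>Diff M\<^esub> ?q b) \<otimes>\<^bsub>Diff M\<^esub> (?q b \<otimes>\<^bsub>Diff M\<^esub> inv\<^bsub>Diff M\<^esub> ?q a) \<in> P"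
      using P le by (auto simp: le_def cone_def)
    also have "(?q c \<otimes>\<^bsub>Diff M\<^esub> inv\<^bsub>Diff M\<^esub> ?q b) \<otimes>\<^bsub>Diff M\<^esub> (?q b \<otimes>\<^bsub>Diff M\<^esub> inv\<^bsub>Diff M\<^esub> ?q a) =
        ?q c \<otimes>\<^bsub>Diff M\<^esub> inv\<^bsub>Diff M\<^esub> ?q a"
      using abc q by (simp add: D.m_assoc D.inv_solve_left')
    finally show "le a c"
      by (simp add: le_def)
  next
    fix a b c assume abc: "a \<in> carrier M" "b \<in> carrier M" "c \<in> carrier M"
    have "?q (b \<otimes>\<^bsub>M\<^esub> c) \<otimes>\<^bsub>Diff M\<^esub> inv\<^bsub>Diff M\<^esub> ?q (a \<otimes>\<^bsub>M\<^esub> c) = ?q b \<otimes>\<^bsub>Diff M\<^esub> inv\<^bsub>Diff M\<^esub> ?q a"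
      using abc q by (simp add: q_mult D.m_assoc D.inv_mult_group cancel)
    then show "le (a \<otimes>\<^bsub>M\<^esub> c) (b \<otimes>\<^bsub>M\<^esub> c) \<longleftrightarrow> le a b"
      by (simp add: le_def)
  qed
  moreover have "le a b \<or> le b a" if "a \<in> carrier M" "b \<in> carrier M" for a b
    using total[of "?q b \<otimes>\<^bsub>Diff M\<^esub> inv\<^bsub>Diff M\<^esub> ?q a"] inv[OF that] q that by (auto simp: le_def)
  ultimately show thesis
    by (rule that)
qed

section \<open>Arithmetic in monoid algebras\<close>

locale monoid_algebra_over = rng: cring R + mon: comm_monoid M
  for R :: "('r, 'q) ring_scheme" and M :: "('m, 's) monoid_scheme"
begin

abbreviation "RM \<equiv> monoid_algebra R M"

lemma coeff_closed [simp]: "u \<in> carrier RM \<Longrightarrow> m \<in> carrier M \<Longrightarrow> u m \<in> carrier R"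
  by (auto simp: monoid_algebra_def)

lemma supp_finite: "u \<in> carrier RM \<Longrightarrow> finite (supp R M u)"
  by (auto simp: monoid_algebra_def)

lemma eqI:
  "\<lbrakk>u \<in> carrier RM; v \<in> carrier RM; \<And>m. m \<in> carrier M \<Longrightarrow> u m = v m\<rbrakk> \<Longrightarrow> u = v"
  by (rule PiE_ext[of _ "carrier M" "\<lambda>_. carrier R"]) (auto simp: monoid_algebra_def)

lemma carrierI:
  assumes "u \<in> carrier M \<rightarrow>\<^sub>E carrier R" "supp R M u \<subseteq> S" "finite S"
  shows "u \<in> carrier RM"
  using assms finite_subset by (auto simp: monoid_algebra_def)

lemma zero_coeff [simp]: "m \<in> carrier M \<Longrightarrow> \<zero>\<^bsub>RM\<^esub> m = \<zero>\<^bsub>R\<^esub>"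
  by (simp add: monoid_algebra_def)

lemma add_coeff [simp]: "m \<in> carrier M \<Longrightarrow> (u \<oplus>\<^bsub>RM\<^esub> v) m = u m \<oplus>\<^bsub>R\<^esub> v m"
  by (simp add: monoid_algebra_def)

lemma zero_closed [simp]: "\<zero>\<^bsub>RM\<^esub> \<in> carrier RM"
  by (rule carrierI[where S = "{}"]) (auto simp: monoid_algebra_def supp_def)

lemma add_closed [simp]:
  assumes "u \<in> carrier RM" "v \<in> carrier RM"
  shows "u \<oplus>\<^bsub>RM\<^esub> v \<in> carrier RM"
  by (rule carrierI[where S = "supp R M u \<union> supp R M v"])
    (use assms supp_finite in \<open>auto simp: monoid_algebra_def supp_def\<close>)

lemma supp_empty_iff:
  assumes "u \<in> carrier RM"
  shows "supp R M u = {} \<longleftrightarrow> u = \<zero>\<^bsub>RM\<^esub>"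
proof
  assume "supp R M u = {}"
  then show "u = \<zero>\<^bsub>RM\<^esub>"
    using assms by (intro eqI) (auto simp: supp_def)
qed (auto simp: supp_def)

lemma abelian_group_monoid_algebra: "abelian_group RM"
proof (rule abelian_groupI)
  fix u assume u: "u \<in> carrier RM"
  define w where "w = (\<lambda>m\<in>carrier M. \<ominus>\<^bsub>R\<^esub> u m)"
  have "w \<in> carrier RM"
    by (rule carrierI[where S = "supp R M u"])
      (use u supp_finite in \<open>auto simp: w_def supp_def\<close>)
  moreover have "w \<oplus>\<^bsub>RM\<^esub> u = \<zero>\<^bsub>RM\<^esub>"
    using u calculation by (intro eqI) (auto simp: w_def rng.l_neg)
  ultimately show "\<exists>v\<in>carrier RM. v \<oplus>\<^bsub>RM\<^esub> u = \<zero>\<^bsub>RM\<^esub>"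
    by blast
qed (auto intro!: eqI simp: rng.a_ac)

lemma neg_coeff:
  assumes "u \<in> carrier RM" "m \<in> carrier M"
  shows "(\<ominus>\<^bsub>RM\<^esub> u) m = \<ominus>\<^bsub>R\<^esub> u m"
proof -
  interpret RM: abelian_group RM by (rule abelian_group_monoid_algebra)
  have "(\<ominus>\<^bsub>RM\<^esub> u) m \<oplus>\<^bsub>R\<^esub> u m = \<zero>\<^bsub>R\<^esub>"
    using assms RM.l_neg[of u] by (metis add_coeff zero_coeff)
  then show ?thesis
    using assms RM.a_inv_closed[of u] by (simp add: rng.minus_equality)
qed

lemma mult_coeff:
  "k \<in> carrier M \<Longrightarrow> (u \<otimes>\<^bsub>RM\<^esub> v) k =
    (\<Oplus>\<^bsub>R\<^esub>p\<in>{p \<in> supp R M u \<times> supp R M v. fst p \<otimes>\<^bsub>M\<^esub> snd p = k}. u (fst p) \<otimes>\<^bsub>R\<^esub> v (snd p))"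
  by (simp add: monoid_algebra_def)

lemma supp_mult:
  "supp R M (u \<otimes>\<^bsub>RM\<^esub> v) \<subseteq> (\<lambda>(a, b). a \<otimes>\<^bsub>M\<^esub> b) ` (supp R M u \<times> supp R M v)"
proof
  fix k assume k: "k \<in> supp R M (u \<otimes>\<^bsub>RM\<^esub> v)"
  then have "{p \<in> supp R M u \<times> supp R M v. fst p \<otimes>\<^bsub>M\<^esub> snd p = k} \<noteq> {}"
    by (auto simp: supp_def[of _ _ "u \<otimes>\<^bsub>RM\<^esub> v"] mult_coeff simp del: Collect_empty_eq)
  then show "k \<in> (\<lambda>(a, b). a \<otimes>\<^bsub>M\<^esub> b) ` (supp R M u \<times> supp R M v)"
    by force
qed

lemma mult_closed [simp]:
  assumes "u \<in> carrier RM" "v \<in> carrier RM"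
  shows "u \<otimes>\<^bsub>RM\<^esub> v \<in> carrier RM"
proof (rule carrierI[OF _ supp_mult])
  show "u \<otimes>\<^bsub>RM\<^esub> v \<in> carrier M \<rightarrow>\<^sub>E carrier R"
    using assms
    by (intro PiE_I) (auto simp: mult_coeff supp_def intro!: rng.finsum_closed rng.m_closed,
      simp add: monoid_algebra_def)
qed (use assms supp_finite in auto)

lemma mult_coeff_unique:
  assumes uv: "u \<in> carrier RM" "v \<in> carrier RM" and mn: "m \<in> carrier M" "n \<in> carrier M"
    and unique: "\<And>a b. a \<in> supp R M u \<Longrightarrow> b \<in> supp R M v \<Longrightarrow> a \<otimes>\<^bsub>M\<^esub> b = m \<otimes>\<^bsub>M\<^esub> n \<Longrightarrow> a = m \<and> b = n"
  shows "(u \<otimes>\<^bsub>RM\<^esub> v) (m \<otimes>\<^bsub>M\<^esub> n) = u m \<otimes>\<^bsub>R\<^esub> v n"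
proof -
  let ?S = "{p \<in> supp R M u \<times> supp R M v. fst p \<otimes>\<^bsub>M\<^esub> snd p = m \<otimes>\<^bsub>M\<^esub> n}"
  have sub: "?S \<subseteq> {(m, n)}"
    using unique by auto
  show ?thesis
  proof (cases "m \<in> supp R M u \<and> n \<in> supp R M v")
    case True
    then have "?S = {(m, n)}"
      using sub by auto
    then show ?thesis
      using uv mn rng.finsum_insert[of "{}" "(m, n)" "\<lambda>p. u (fst p) \<otimes>\<^bsub>R\<^esub> v (snd p)"]
      by (simp add: mult_coeff)
  next
    case False
    then have "?S = {}"
      using sub by auto
    moreover have "u m = \<zero>\<^bsub>R\<^esub> \<or> v n = \<zero>\<^bsub>R\<^esub>"
      using False mn by (auto simp: supp_def)
    ultimately show ?thesis
      using uv mn by (auto simp: mult_coeff simp del: Collect_empty_eq)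
  qed
qed

lemma one_eq_mterm: "\<one>\<^bsub>RM\<^esub> = mterm R M \<one>\<^bsub>R\<^esub> \<one>\<^bsub>M\<^esub>"
  by (simp add: monoid_algebra_def mterm_def)

lemma supp_mterm: "supp R M (mterm R M r m) \<subseteq> {m}"
  by (auto simp: supp_def mterm_def)

lemma mterm_closed [simp]: "r \<in> carrier R \<Longrightarrow> mterm R M r m \<in> carrier RM"
  by (rule carrierI[OF _ supp_mterm]) (auto simp: mterm_def)

lemma mterm_coeff: "n \<in> carrier M \<Longrightarrow> mterm R M r m n = (if n = m then r else \<zero>\<^bsub>R\<^esub>)"
  by (simp add: mterm_def)

lemma mterm_eq_zero_iff:
  assumes "m \<in> carrier M"
  shows "mterm R M r m = \<zero>\<^bsub>RM\<^esub> \<longleftrightarrow> r = \<zero>\<^bsub>R\<^esub>"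
proof
  assume "mterm R M r m = \<zero>\<^bsub>RM\<^esub>"
  from fun_cong[OF this, of m] show "r = \<zero>\<^bsub>R\<^esub>"
    using assms by (simp add: mterm_coeff)
qed (auto simp: mterm_def monoid_algebra_def)

lemma mterm_mult:
  assumes rs: "r \<in> carrier R" "s \<in> carrier R" and mn: "m \<in> carrier M" "n \<in> carrier M"
  shows "mterm R M r m \<otimes>\<^bsub>RM\<^esub> mterm R M s n = mterm R M (r \<otimes>\<^bsub>R\<^esub> s) (m \<otimes>\<^bsub>M\<^esub> n)" (is "?u \<otimes>\<^bsub>RM\<^esub> ?v = ?w")
proof (rule eqI)
  fix k assume k: "k \<in> carrier M"
  show "(?u \<otimes>\<^bsub>RM\<^esub> ?v) k = ?w k"
  proof (cases "k = m \<otimes>\<^bsub>M\<^esub> n")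
    case True
    have "(?u \<otimes>\<^bsub>RM\<^esub> ?v) (m \<otimes>\<^bsub>M\<^esub> n) = ?u m \<otimes>\<^bsub>R\<^esub> ?v n"
      using rs mn supp_mterm by (intro mult_coeff_unique) (auto dest!: subsetD[OF supp_mterm])
    then show ?thesis
      using True mn by (simp add: mterm_coeff)
  next
    case False
    have "k \<notin> supp R M (?u \<otimes>\<^bsub>RM\<^esub> ?v)"
    proof
      assume "k \<in> supp R M (?u \<otimes>\<^bsub>RM\<^esub> ?v)"
      then obtain a b where "a \<in> supp R M ?u" "b \<in> supp R M ?v" "k = a \<otimes>\<^bsub>M\<^esub> b"
        using subsetD[OF supp_mult, of k ?u ?v] by auto
      then show False
        using False supp_mterm by blast
    qed
    then show ?thesis
      using False k by (simp add: supp_def mterm_coeff)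
  qed
qed (use assms in auto)

lemma mterm_one_pow:
  assumes "r \<in> carrier R"
  shows "mterm R M r \<one>\<^bsub>M\<^esub> [^]\<^bsub>RM\<^esub> (n::nat) = mterm R M (r [^]\<^bsub>R\<^esub> n) \<one>\<^bsub>M\<^esub>"
  using assms by (induction n) (simp_all add: one_eq_mterm mterm_mult)

lemma pow_closed: "u \<in> carrier RM \<Longrightarrow> u [^]\<^bsub>RM\<^esub> (n::nat) \<in> carrier RM"
  by (induction n) (simp_all add: one_eq_mterm)

lemma nontrivial_iff: "carrier RM \<noteq> {\<zero>\<^bsub>RM\<^esub>} \<longleftrightarrow> carrier R \<noteq> {\<zero>\<^bsub>R\<^esub>}"
proof
  assume "carrier RM \<noteq> {\<zero>\<^bsub>RM\<^esub>}"
  then obtain u where "u \<in> carrier RM" "u \<noteq> \<zero>\<^bsub>RM\<^esub>"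
    using zero_closed by blast
  then obtain m where "m \<in> carrier M" "u m \<in> carrier R" "u m \<noteq> \<zero>\<^bsub>R\<^esub>"
    using supp_empty_iff by (force simp: supp_def)
  then show "carrier R \<noteq> {\<zero>\<^bsub>R\<^esub>}"
    by auto
next
  assume "carrier R \<noteq> {\<zero>\<^bsub>R\<^esub>}"
  then obtain r where "r \<in> carrier R" "r \<noteq> \<zero>\<^bsub>R\<^esub>"
    using rng.zero_closed by blast
  then have "mterm R M r \<one>\<^bsub>M\<^esub> \<in> carrier RM" "mterm R M r \<one>\<^bsub>M\<^esub> \<noteq> \<zero>\<^bsub>RM\<^esub>"
    by (simp_all add: mterm_eq_zero_iff)
  then show "carrier RM \<noteq> {\<zero>\<^bsub>RM\<^esub>}"
    by auto
qed

lemma nonzerodivisor_mterm_one: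
  assumes "r \<in> carrier R" "nonzerodivisor RM (mterm R M r \<one>\<^bsub>M\<^esub>)"
  shows "nonzerodivisor R r"
  unfolding nonzerodivisor_def
proof (intro conjI ballI impI)
  fix s assume s: "s \<in> carrier R" "r \<otimes>\<^bsub>R\<^esub> s = \<zero>\<^bsub>R\<^esub>"
  then have "mterm R M r \<one>\<^bsub>M\<^esub> \<otimes>\<^bsub>RM\<^esub> mterm R M s \<one>\<^bsub>M\<^esub> = \<zero>\<^bsub>RM\<^esub>"
    using assms by (simp add: mterm_mult mterm_eq_zero_iff)
  then have "mterm R M s \<one>\<^bsub>M\<^esub> = \<zero>\<^bsub>RM\<^esub>"
    using assms s by (auto simp: nonzerodivisor_def)
  then show "s = \<zero>\<^bsub>R\<^esub>"
    by (simp add: mterm_eq_zero_iff)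
qed fact

lemma nilpotent_mterm_one:
  assumes "nilpotent R r"
  shows "nilpotent RM (mterm R M r \<one>\<^bsub>M\<^esub>)"
  using assms by (auto simp: nilpotent_def mterm_one_pow mterm_eq_zero_iff)

end

section \<open>Leading terms\<close>

locale ordered_monoid_algebra = monoid_algebra_over R M + ord: translation_order M le
  for R :: "('r, 'q) ring_scheme" and M :: "('m, 's) monoid_scheme" and le :: "'m \<Rightarrow> 'm \<Rightarrow> bool"
begin

text \<open>
  The other factor \<open>v\<close> need not be homogeneous, so its support may contain incomparable elements
  and have no greatest element; a maximal one is enough.
\<close>

lemma nonzerodivisor_leading:
  assumes u: "u \<in> carrier RM" and m: "m \<in> carrier M" "\<And>a. a \<in> supp R M u \<Longrightarrow> le a m"
    and nzd: "nonzerodivisor R (u m)"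
  shows "nonzerodivisor RM u"
  unfolding nonzerodivisor_def
proof (intro conjI ballI impI)
  fix v assume v: "v \<in> carrier RM" and uv: "u \<otimes>\<^bsub>RM\<^esub> v = \<zero>\<^bsub>RM\<^esub>"
  show "v = \<zero>\<^bsub>RM\<^esub>"
  proof (rule ccontr)
    assume "v \<noteq> \<zero>\<^bsub>RM\<^esub>"
    then have "supp R M v \<noteq> {}" "supp R M v \<subseteq> carrier M"
      using supp_empty_iff[OF v] by (auto simp: supp_def)
    then obtain n where n: "n \<in> supp R M v" "\<And>b. b \<in> supp R M v \<Longrightarrow> le n b \<Longrightarrow> b = n"
      using ord.finite_maximal[OF supp_finite[OF v]] by metis
    have nM: "n \<in> carrier M" and vn: "v n \<noteq> \<zero>\<^bsub>R\<^esub>"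
      using n(1) by (auto simp: supp_def)
    have "(u \<otimes>\<^bsub>RM\<^esub> v) (m \<otimes>\<^bsub>M\<^esub> n) = u m \<otimes>\<^bsub>R\<^esub> v n"
    proof (rule mult_coeff_unique[OF u v m(1) nM])
      fix a b assume "a \<in> supp R M u" "b \<in> supp R M v" "a \<otimes>\<^bsub>M\<^esub> b = m \<otimes>\<^bsub>M\<^esub> n"
      then show "a = m \<and> b = n"
        using m n nM by (intro ord.unique_product) (auto simp: supp_def)
    qed
    then have "u m \<otimes>\<^bsub>R\<^esub> v n = \<zero>\<^bsub>R\<^esub>"
      using uv m nM by simp
    then show False
      using nzd vn v nM by (auto simp: nonzerodivisor_def)
  qed
qed fact

text \<open>
  The bound on the support is part of the induction hypothesis, because the next multiplication by
  \<open>u\<close> is evaluated at the product of the two bounds.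
\<close>

lemma pow_leading:
  assumes u: "u \<in> carrier RM" and m: "m \<in> carrier M" "\<And>a. a \<in> supp R M u \<Longrightarrow> le a m"
  shows "(u [^]\<^bsub>RM\<^esub> (k::nat)) (m [^]\<^bsub>M\<^esub> k) = u m [^]\<^bsub>R\<^esub> k \<and>
    (\<forall>a\<in>supp R M (u [^]\<^bsub>RM\<^esub> k). le a (m [^]\<^bsub>M\<^esub> k))"
proof (induction k)
  case 0
  show ?case
    using subsetD[OF supp_mterm[of "\<one>\<^bsub>R\<^esub>" "\<one>\<^bsub>M\<^esub>"]]
    by (auto simp: one_eq_mterm mterm_coeff intro: ord.le_refl)
next
  case (Suc k)
  let ?w = "u [^]\<^bsub>RM\<^esub> k"
  have w: "?w \<in> carrier RM" and mk: "m [^]\<^bsub>M\<^esub> k \<in> carrier M"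
    using u m by (simp_all add: pow_closed)
  have "(?w \<otimes>\<^bsub>RM\<^esub> u) (m [^]\<^bsub>M\<^esub> k \<otimes>\<^bsub>M\<^esub> m) = ?w (m [^]\<^bsub>M\<^esub> k) \<otimes>\<^bsub>R\<^esub> u m"
  proof (rule mult_coeff_unique[OF w u mk m(1)])
    fix a b assume "a \<in> supp R M ?w" "b \<in> supp R M u" "a \<otimes>\<^bsub>M\<^esub> b = m [^]\<^bsub>M\<^esub> k \<otimes>\<^bsub>M\<^esub> m"
    then show "a = m [^]\<^bsub>M\<^esub> k \<and> b = m"
      using m mk Suc.IH by (intro ord.unique_product) (auto simp: supp_def intro: ord.le_antisym)
  qed
  moreover have "le c (m [^]\<^bsub>M\<^esub> k \<otimes>\<^bsub>M\<^esub> m)" if c: "c \<in> supp R M (?w \<otimes>\<^bsub>RM\<^esub> u)" for c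
  proof -
    obtain a b where ab: "a \<in> supp R M ?w" "b \<in> supp R M u" "c = a \<otimes>\<^bsub>M\<^esub> b"
      using subsetD[OF supp_mult c] by auto
    then have "a \<in> carrier M" "b \<in> carrier M"
      by (auto simp: supp_def)
    then show ?thesis
      using ab m mk Suc.IH by (auto intro: ord.mult_mono)
  qed
  ultimately show ?case
    using Suc.IH by simp
qed

lemma nilpotent_leading:
  assumes u: "u \<in> carrier RM" and m: "m \<in> carrier M" "\<And>a. a \<in> supp R M u \<Longrightarrow> le a m"
    and nil: "nilpotent RM u"
  shows "nilpotent R (u m)"
proof -
  obtain k :: nat where "u [^]\<^bsub>RM\<^esub> k = \<zero>\<^bsub>RM\<^esub>"
    using nil by (auto simp: nilpotent_def)
  then have "u m [^]\<^bsub>R\<^esub> k = \<zero>\<^bsub>R\<^esub>"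
    using pow_leading[OF u m, of k] m(1) by simp
  then show ?thesis
    using u m by (auto simp: nilpotent_def)
qed

end

section \<open>Homogeneous elements of graded monoid algebras\<close>

text \<open>
  Since \<open>\<delta> g m = h\<close> determines \<open>g\<close> from \<open>m\<close>, all generators \<open>r e\<^sub>m\<close> of the component of degree
  \<open>h\<close> with a given \<open>m\<close> have their \<open>r\<close> in the same component of \<open>R\<close>. So no sums of homogeneous
  elements of distinct degrees arise as coefficients.
\<close>

lemma algebra_grading_coeff:
  assumes gr: "graded_ring G R A" and M: "comm_monoid M"
    and inj: "\<And>m. m \<in> carrier M \<Longrightarrow> inj_on (\<lambda>g. \<delta> g m) (carrier G)"
    and u: "u \<in> algebra_grading G R A M \<delta> h"
  shows "u \<in> carrier (monoid_algebra R M)"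
    and "m \<in> supp R M u \<Longrightarrow> \<exists>g\<in>carrier G. \<delta> g m = h \<and> u m \<in> A g"
proof -
  interpret graded_ring G R A by fact
  interpret monoid_algebra_over R M
    using rng.cring_axioms M by (simp add: monoid_algebra_over_def)
  interpret RM: abelian_group RM by (rule abelian_group_monoid_algebra)
  define B where "B m = {\<zero>\<^bsub>R\<^esub>} \<union> {r. \<exists>g\<in>carrier G. \<delta> g m = h \<and> r \<in> A g}" for m
  have A: "additive_subgroup (A g) R" if "g \<in> carrier G" for g
    by (rule component_subgroup) fact
  have A_closed: "r \<in> carrier R" if "g \<in> carrier G" "r \<in> A g" for g r
    using additive_subgroup.a_Hcarr[OF A] that by blast
  have A_neg: "\<ominus>\<^bsub>R\<^esub> r \<in> A g" if "g \<in> carrier G" "r \<in> A g" for g r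
    using additive_subgroup.a_inv_closed[OF A] rng.abelian_group_axioms that by blast
  have B_closed: "r \<in> carrier R" if "r \<in> B m" for r m
    using that A_closed by (auto simp: B_def)
  have B_neg: "\<ominus>\<^bsub>R\<^esub> r \<in> B m" if "r \<in> B m" for r m
    using that A_neg by (auto simp: B_def)
  have B_add: "r \<oplus>\<^bsub>R\<^esub> s \<in> B m" if m: "m \<in> carrier M" and r: "r \<in> B m" and s: "s \<in> B m" for r s m
  proof (cases "r = \<zero>\<^bsub>R\<^esub> \<or> s = \<zero>\<^bsub>R\<^esub>")
    case True
    then show ?thesis
      using r s B_closed[of r] B_closed[of s] by auto
  next
    case False
    then obtain g g' where g: "g \<in> carrier G" "\<delta> g m = h" "r \<in> A g"
      and g': "g' \<in> carrier G" "\<delta> g' m = h" "s \<in> A g'"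
      using r s by (auto simp: B_def)
    then have "g' = g"
      using inj[OF m] by (auto simp: inj_on_def)
    then have "r \<oplus>\<^bsub>R\<^esub> s \<in> A g"
      using g g' additive_subgroup.a_closed[OF A] by blast
    then show ?thesis
      using g by (auto simp: B_def)
  qed
  have gen: "mterm R M r n \<in> carrier RM \<and> (\<forall>m\<in>carrier M. mterm R M r n m \<in> B m)"
    if "g \<in> carrier G" "r \<in> A g" "\<delta> g n = h" for g r n
    using that A_closed by (auto simp: mterm_coeff B_def)
  have "u \<in> carrier RM \<and> (\<forall>m\<in>carrier M. u m \<in> B m)"
    using u unfolding algebra_grading_def
  proof (induction rule: generate.induct)
    case one
    then show ?case by (simp add: B_def)
  next
    case (incl v)
    then show ?case using gen by blast
  next
    case (inv v)
    then have v: "v \<in> carrier RM" "\<forall>m\<in>carrier M. v m \<in> B m"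
      using gen by blast+
    then have "\<ominus>\<^bsub>RM\<^esub> v \<in> carrier RM \<and> (\<forall>m\<in>carrier M. (\<ominus>\<^bsub>RM\<^esub> v) m \<in> B m)"
      using B_neg by (simp add: neg_coeff)
    then show ?case by (simp add: a_inv_def)
  next
    case (eng v w)
    then show ?case using B_add by simp
  qed
  then show "u \<in> carrier RM"
    and "m \<in> supp R M u \<Longrightarrow> \<exists>g\<in>carrier G. \<delta> g m = h \<and> u m \<in> A g"
    by (auto simp: supp_def B_def)
qed

text \<open>
  The order need only compare elements within the support of a single homogeneous element. This
  is why equality will do for the fine graduation, where such a support has at most one element.
\<close>

lemma algebra_grading_transfer:
  fixes M :: "('m, 's) monoid_scheme" and le :: "'m \<Rightarrow> 'm \<Rightarrow> bool"
  assumes gr: "graded_ring G R A" and ord: "translation_order M le"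
    and inj: "\<And>m. m \<in> carrier M \<Longrightarrow> inj_on (\<lambda>g. \<delta> g m) (carrier G)"
    and one: "\<And>g. g \<in> carrier G \<Longrightarrow> \<delta> g \<one>\<^bsub>M\<^esub> \<in> carrier H"
    and comparable: "\<And>u a b. \<lbrakk>u \<in> homogeneous H (algebra_grading G R A M \<delta>);
      a \<in> supp R M u; b \<in> supp R M u\<rbrakk> \<Longrightarrow> le a b \<or> le b a"
  shows "graded_entire G R A \<longleftrightarrow>
      graded_entire H (monoid_algebra R M) (algebra_grading G R A M \<delta>)" (is ?entire)
    and "graded_reduced G R A \<longleftrightarrow>
      graded_reduced H (monoid_algebra R M) (algebra_grading G R A M \<delta>)" (is ?reduced)
proof -
  interpret graded_ring G R A by fact
  interpret ord: translation_order M le by fact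
  interpret ordered_monoid_algebra R M le
    by unfold_locales
  let ?A = "algebra_grading G R A M \<delta>"
  have const_coeff: "r \<in> carrier R" "mterm R M r \<one>\<^bsub>M\<^esub> \<in> homogeneous H ?A"
    if r: "r \<in> homogeneous G A" for r
  proof -
    obtain g where g: "g \<in> carrier G" "r \<in> A g"
      using r by (auto simp: homogeneous_def)
    then show "r \<in> carrier R"
      using additive_subgroup.a_Hcarr[OF component_subgroup] by blast
    have "mterm R M r \<one>\<^bsub>M\<^esub> \<in> ?A (\<delta> g \<one>\<^bsub>M\<^esub>)"
      unfolding algebra_grading_def using g ord.one_closed by (intro generate.incl) blast
    then show "mterm R M r \<one>\<^bsub>M\<^esub> \<in> homogeneous H ?A"
      using one g by (auto simp: homogeneous_def)
  qed
  have leading: "\<exists>m\<in>carrier M. u \<in> carrier RM \<and> (\<forall>a\<in>supp R M u. le a m) \<and>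
      u m \<noteq> \<zero>\<^bsub>R\<^esub> \<and> u m \<in> homogeneous G A"
    if u: "u \<in> homogeneous H ?A" "u \<noteq> \<zero>\<^bsub>RM\<^esub>" for u
  proof -
    obtain h where h: "u \<in> ?A h"
      using u by (auto simp: homogeneous_def)
    have uc: "u \<in> carrier RM"
      by (rule algebra_grading_coeff(1)[OF gr ord.comm_monoid_axioms inj h])
    have S: "supp R M u \<noteq> {}" "supp R M u \<subseteq> carrier M"
      using supp_empty_iff[OF uc] u by (auto simp: supp_def)
    obtain m where m: "m \<in> supp R M u" and max: "\<And>b. b \<in> supp R M u \<Longrightarrow> le m b \<Longrightarrow> b = m"
      using ord.finite_maximal[OF supp_finite[OF uc] S] by metis
    have "le a m" if "a \<in> supp R M u" for a
      using comparable[OF u(1) that m] max[OF that] m S by (auto intro: ord.le_refl)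
    moreover have "u m \<in> homogeneous G A"
      using algebra_grading_coeff(2)[OF gr ord.comm_monoid_axioms inj h m]
      by (auto simp: homogeneous_def)
    ultimately show ?thesis
      using m uc by (auto simp: supp_def)
  qed
  show ?entire
    unfolding graded_entire_def nontrivial_iff
  proof (intro conj_cong refl iffI ballI impI)
    fix u assume R: "\<forall>x\<in>homogeneous G A. x \<noteq> \<zero>\<^bsub>R\<^esub> \<longrightarrow> nonzerodivisor R x"
      and u: "u \<in> homogeneous H ?A" "u \<noteq> \<zero>\<^bsub>RM\<^esub>"
    show "nonzerodivisor RM u"
      using leading[OF u] R nonzerodivisor_leading by blast
  next
    fix r assume RM: "\<forall>x\<in>homogeneous H ?A. x \<noteq> \<zero>\<^bsub>RM\<^esub> \<longrightarrow> nonzerodivisor RM x"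
      and r: "r \<in> homogeneous G A" "r \<noteq> \<zero>\<^bsub>R\<^esub>"
    show "nonzerodivisor R r"
      using const_coeff[OF r(1)] r RM nonzerodivisor_mterm_one by (simp add: mterm_eq_zero_iff)
  qed
  show ?reduced
    unfolding graded_reduced_def
  proof (intro iffI ballI impI)
    fix u assume R: "\<forall>x\<in>homogeneous G A. x \<noteq> \<zero>\<^bsub>R\<^esub> \<longrightarrow> \<not> nilpotent R x"
      and u: "u \<in> homogeneous H ?A" "u \<noteq> \<zero>\<^bsub>RM\<^esub>"
    show "\<not> nilpotent RM u"
      using leading[OF u] R nilpotent_leading by blast
  next
    fix r assume RM: "\<forall>x\<in>homogeneous H ?A. x \<noteq> \<zero>\<^bsub>RM\<^esub> \<longrightarrow> \<not> nilpotent RM x"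
      and r: "r \<in> homogeneous G A" "r \<noteq> \<zero>\<^bsub>R\<^esub>"
    show "\<not> nilpotent R r"
      using const_coeff[OF r(1)] r RM nilpotent_mterm_one by (auto simp: mterm_eq_zero_iff)
  qed
qed

lemma fine_grading_transfer:
  assumes gr: "graded_ring G R A" and M: "comm_monoid M" "cancellable M"
  shows "graded_entire G R A \<longleftrightarrow>
      graded_entire (G \<times>\<times> Diff M) (monoid_algebra R M) (fine_grading G R A M)"
    and "graded_reduced G R A \<longleftrightarrow>
      graded_reduced (G \<times>\<times> Diff M) (monoid_algebra R M) (fine_grading G R A M)"
proof -
  interpret M: comm_monoid M by fact
  let ?\<delta> = "\<lambda>g m. (g, to_Diff M m)"
  have inj: "inj_on (\<lambda>g. ?\<delta> g m) (carrier G)" for m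
    by (auto simp: inj_on_def)
  have one: "?\<delta> g \<one>\<^bsub>M\<^esub> \<in> carrier (G \<times>\<times> Diff M)" if "g \<in> carrier G" for g
    using that to_Diff_hom[OF M(1)] by (auto simp: hom_def)
  have single: "a = b \<or> b = a"
    if u: "u \<in> homogeneous (G \<times>\<times> Diff M) (algebra_grading G R A M ?\<delta>)"
      and ab: "a \<in> supp R M u" "b \<in> supp R M u" for u a b
  proof -
    obtain h where h: "u \<in> algebra_grading G R A M ?\<delta> h"
      using u by (auto simp: homogeneous_def)
    have "to_Diff M a = to_Diff M b"
      using algebra_grading_coeff(2)[OF gr M(1) inj h] ab by (metis snd_conv)
    moreover have "a \<in> carrier M" "b \<in> carrier M"
      using ab by (auto simp: supp_def)
    ultimately show ?thesis
      using cancellable_iff_inj_to_Diff[OF M(1)] M(2) by (auto simp: inj_on_def)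
  qed
  note tr = algebra_grading_transfer[where \<delta> = ?\<delta>, OF gr cancellable_translation_order[OF M] inj one single]
  show "graded_entire G R A \<longleftrightarrow>
      graded_entire (G \<times>\<times> Diff M) (monoid_algebra R M) (fine_grading G R A M)"
    unfolding fine_grading_def by (rule tr(1))
  show "graded_reduced G R A \<longleftrightarrow>
      graded_reduced (G \<times>\<times> Diff M) (monoid_algebra R M) (fine_grading G R A M)"
    unfolding fine_grading_def by (rule tr(2))
qed

lemma coarse_grading_transfer:
  assumes gr: "graded_ring G R A" and M: "comm_monoid M" "cancellable M" "torsionfree_monoid M"
    and d: "d \<in> hom M G"
  shows "graded_entire G R A \<longleftrightarrow>
      graded_entire G (monoid_algebra R M) (coarse_grading G R A M d)"
    and "graded_reduced G R A \<longleftrightarrow>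
      graded_reduced G (monoid_algebra R M) (coarse_grading G R A M d)"
proof -
  interpret M: comm_monoid M by fact
  interpret graded_ring G R A by fact
  let ?\<delta> = "\<lambda>g m. g \<otimes>\<^bsub>G\<^esub> d m"
  obtain le where ord: "translation_order M le"
    and total: "\<And>a b. a \<in> carrier M \<Longrightarrow> b \<in> carrier M \<Longrightarrow> le a b \<or> le b a"
    using torsionfree_translation_order[OF M] by blast
  have d_closed: "d m \<in> carrier G" if "m \<in> carrier M" for m
    using d that by (auto simp: hom_def)
  have inj: "inj_on (\<lambda>g. ?\<delta> g m) (carrier G)" if "m \<in> carrier M" for m
    using d_closed[OF that] by (auto simp: inj_on_def)
  have one: "?\<delta> g \<one>\<^bsub>M\<^esub> \<in> carrier G" if "g \<in> carrier G" for g
    using that d_closed by simp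
  have comparable: "le a b \<or> le b a" if "a \<in> supp R M u" "b \<in> supp R M u" for u a b
    using total that by (auto simp: supp_def)
  note tr = algebra_grading_transfer[where \<delta> = ?\<delta>, OF gr ord inj one comparable]
  show "graded_entire G R A \<longleftrightarrow>
      graded_entire G (monoid_algebra R M) (coarse_grading G R A M d)"
    unfolding coarse_grading_def by (rule tr(1))
  show "graded_reduced G R A \<longleftrightarrow>
      graded_reduced G (monoid_algebra R M) (coarse_grading G R A M d)"
    unfolding coarse_grading_def by (rule tr(2))
qed

theorem mainTheorem5:
  fixes G :: "('g, 'p) monoid_scheme" and R :: "('r, 'q) ring_scheme" and A :: "'g \<Rightarrow> 'r set"
  assumes "graded_ring G R A"
  shows
    "(\<forall>M :: ('m, 's) monoid_scheme. comm_monoid M \<and> cancellable M \<longrightarrow>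
        (graded_entire G R A \<longleftrightarrow>
          graded_entire (G \<times>\<times> Diff M) (monoid_algebra R M) (fine_grading G R A M)) \<and>
        (graded_reduced G R A \<longleftrightarrow>
          graded_reduced (G \<times>\<times> Diff M) (monoid_algebra R M) (fine_grading G R A M))) \<and>
     (\<forall>(M :: ('m, 's) monoid_scheme) d.
        comm_monoid M \<and> cancellable M \<and> torsionfree_monoid M \<and> d \<in> hom M G \<longrightarrow>
        (graded_entire G (monoid_algebra R M) (coarse_grading G R A M d) \<longleftrightarrow>
          graded_entire G R A) \<and>
        (graded_reduced G (monoid_algebra R M) (coarse_grading G R A M d) \<longleftrightarrow>
          graded_reduced G R A))"
  using fine_grading_transfer[OF assms] coarse_grading_transfer[OF assms] by blast

end
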